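(* Let $A=[a_{ij}]_{i,j=1}^n\in\mathbb{R}^{n\times n}$ be a nonnegative, irreducible matrix and let $i_0,j_0\in\{1,\dots,n\}$. Let $l$ denote the length of the shortest cycle in the graph of the matrix $A+e_{i_0}e_{j_0}^\top$ containing the $(i_0,j_0)$ edge. Then the matrix $$A+\tau e_{i_0}e_{j_0}^\top,\quad\tau>0,$$ has precisely $l$ eigenvalues converging to infinity with $\tau\to+\infty$.
   Context: Nonnegative means entrywise nonnegative. A nonnegative matrix $A$ is irreducible if there is no permutation matrix $P$ such that $P^\top AP=\begin{bmatrix}X&Y\\0&Z\end{bmatrix}$ with $X$ and $Z$ nontrivial square matrices. The graph associated with a matrix $A=[a_{ij}]_{i,j=1}^n$ is the directed graph with vertices $1,\dots,n$ whose edges are exactly the pairs $(i,j)$ with $a_{ij}>0$. A cycle is a directed path from a vertex $i$ to itself; its length is its number of edges. $e_i$ is the $i$-th standard unit vector. Eigenvalues are counted with algebraic multiplicity. *)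

theory Defs
  imports
    "HOL-Analysis.Analysis"
    "HOL-Combinatorics.Permutations"
    "Jordan_Normal_Form.Char_Poly"
    "Graph_Theory.Pair_Digraph"
begin

definition nonneg_mat :: "real mat \<Rightarrow> bool" where
  "nonneg_mat A \<longleftrightarrow> (\<forall>i < dim_row A. \<forall>j < dim_col A. 0 \<le> A $$ (i, j))"

definition permutation_mat :: "nat \<Rightarrow> real mat \<Rightarrow> bool" where
  "permutation_mat n P \<longleftrightarrow>
     (\<exists>p. p permutes {..<n} \<and> P = mat n n (\<lambda>(i, j). if i = p j then 1 else 0))"

(* Every 1 x 1 matrix, including the zero matrix, is irreducible. *)
definition irreducible_mat :: "real mat \<Rightarrow> bool" where
  "irreducible_mat A \<longleftrightarrow> square_mat A \<and>
     \<not> (\<exists>P X Y Z k m. permutation_mat (dim_row A) P \<and> 0 < k \<and> 0 < m \<and>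
          X \<in> carrier_mat k k \<and> Y \<in> carrier_mat k m \<and> Z \<in> carrier_mat m m \<and>
          transpose_mat P * A * P = four_block_mat X Y (0\<^sub>m m k) Z)"

(* Matrix indices, hence vertices, are counted from 0. *)
definition mat_graph :: "real mat \<Rightarrow> nat pair_pre_digraph" where
  "mat_graph A = \<lparr> pverts = {..<dim_row A},
     parcs = {(i, j). i < dim_row A \<and> j < dim_col A \<and> A $$ (i, j) > 0} \<rparr>"

(* A cycle of the graph library is a nonempty closed walk, given as its list of arcs, that
   repeats no vertex apart from start = end; loops are cycles of length 1. *)
definition shortest_cycle_length_through :: "'a pair_pre_digraph \<Rightarrow> 'a \<times> 'a \<Rightarrow> nat" where
  "shortest_cycle_length_through G e =
     (LEAST m. \<exists>c. pre_digraph.cycle (with_proj G) c \<and> e \<in> set c \<and> length c = m)"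

text \<open>The rank-one matrix \<open>e\<^sub>i e\<^sub>j\<^sup>T\<close>.\<close>
definition unit_outer :: "nat \<Rightarrow> nat \<Rightarrow> nat \<Rightarrow> real mat" where
  "unit_outer n i j = mat_of_cols n [unit_vec n i] * mat_of_rows n [unit_vec n j]"

text \<open>Complex eigenvalues, each with its algebraic multiplicity.\<close>
definition eigenvalue_mset :: "real mat \<Rightarrow> complex multiset" where
  "eigenvalue_mset A = proots (char_poly (map_mat complex_of_real A))"

text \<open>\<open>lam 0 \<tau>, \<dots>, lam (n - 1) \<tau>\<close> list the eigenvalues of \<open>M \<tau>\<close> with multiplicity.\<close>
definition eigenvalue_functions ::
    "nat \<Rightarrow> (real \<Rightarrow> real mat) \<Rightarrow> (nat \<Rightarrow> real \<Rightarrow> complex) \<Rightarrow> bool" where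
  "eigenvalue_functions n M lam \<longleftrightarrow>
     (\<forall>\<tau> > 0. eigenvalue_mset (M \<tau>) = image_mset (\<lambda>k. lam k \<tau>) (mset_set {..<n}))"

text \<open>
  A listing of eigenvalues may permute the labels at each \<open>\<tau>\<close>, so the bare number of its members
  that tend to infinity depends on the listing. Requiring the other members to stay bounded for
  large \<open>\<tau>\<close> removes this dependence: at most one \<open>l\<close> satisfies the condition below, and for every
  listing by continuous functions exactly that many members tend to infinity.
\<close>
definition precisely_eigenvalues_to_infinity :: "nat \<Rightarrow> (real \<Rightarrow> real mat) \<Rightarrow> nat \<Rightarrow> bool" where
  "precisely_eigenvalues_to_infinity n M l \<longleftrightarrow>
     (\<exists>lam. eigenvalue_functions n M lam \<and>
        card {k \<in> {..<n}. filterlim (lam k) at_infinity at_top} = l \<and>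
        (\<forall>k < n. filterlim (lam k) at_infinity at_top \<or> Bfun (lam k) at_top))"

end

theory Submission
  imports Defs "HOL-Complex_Analysis.Residue_Theorem"
begin

text \<open>
  The characteristic polynomial of \<open>A + \<tau> e\<^sub>i e\<^sub>j\<^sup>T\<close> is \<open>p - \<tau> q\<close>, where \<open>p\<close> is that of \<open>A\<close> and \<open>q\<close> is
  the \<open>(i, j)\<close> cofactor of \<open>x I - A\<close>. The power series of \<open>q / p\<close> in \<open>1 / x\<close> has the coefficients
  \<open>(A\<^sup>k)\<^sub>j\<^sub>i\<close>, which by nonnegativity first become nonzero when \<open>k\<close> is the distance \<open>d\<close> from \<open>j\<close> to \<open>i\<close>
  in the graph of \<open>A\<close>. Hence \<open>deg q = n - 1 - d = n - l\<close>; irreducibility makes \<open>d\<close> finite.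
  By Rouche's theorem every large disc contains exactly \<open>deg q\<close> roots of \<open>p - \<tau> q\<close> once \<open>\<tau>\<close> is large
  enough, so exactly \<open>l\<close> eigenvalues escape to infinity while the others stay bounded.
\<close>

section \<open>Counting roots of polynomials in discs with Rouche's theorem\<close>

lemma zorder_poly:
  fixes h :: "complex poly"
  assumes "h \<noteq> 0"
  shows "zorder (poly h) z = int (order z h)"
proof -
  obtain q where q: "h = [:- z, 1:] ^ order z h * q" "\<not> [:- z, 1:] dvd q"
    using order_decomp[OF assms] by blast
  show ?thesis
  proof (rule zorder_eqI[OF open_UNIV UNIV_I])
    show "poly q z \<noteq> 0"
      using q(2) by (simp add: poly_eq_0_iff_dvd)
    show "poly h w = poly q w * (w - z) powi int (order z h)" for w
      by (subst q(1)) simp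
  qed (auto intro: holomorphic_intros)
qed

text \<open>Converts the weighted sums in \<open>Rouche_theorem\<close> into root counts: the
  winding number is 1 inside the circle and 0 outside, and \<open>zorder\<close> is the
  multiplicity. Excluding roots on the circle leaves no third case.\<close>

lemma sum_winding_number_circlepath_proots:
  fixes h :: "complex poly"
  assumes "r > 0" and nz: "\<And>z. cmod z = r \<Longrightarrow> poly h z \<noteq> 0"
  shows "(\<Sum>z | poly h z = 0. winding_number (circlepath 0 r) z * zorder (poly h) z)
           = of_nat (size {#z \<in># proots h. cmod z < r#})"
proof -
  have h: "h \<noteq> 0"
    using nz[of "of_real r"] \<open>r > 0\<close> by auto
  have fin: "finite {z. poly h z = 0}"
    using h by (rule poly_roots_finite)
  have "(\<Sum>z | poly h z = 0. winding_number (circlepath 0 r) z * zorder (poly h) z)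
          = (\<Sum>z | poly h z = 0. if cmod z < r then of_nat (order z h) else 0)"
  proof (rule sum.cong[OF refl])
    fix z assume "z \<in> {z. poly h z = 0}"
    with nz have "cmod z \<noteq> r" by blast
    then consider "cmod z < r" | "cmod z > r" by linarith
    then show "winding_number (circlepath 0 r) z * zorder (poly h) z
                 = (if cmod z < r then of_nat (order z h) else 0)"
    proof cases
      case 1
      then show ?thesis
        by (simp add: winding_number_circlepath zorder_poly[OF h])
    next
      case 2
      have "winding_number (circlepath 0 r) z = 0"
        by (rule winding_number_zero_outside[of _ "cball 0 r"]) (use 2 \<open>r > 0\<close> in auto)
      then show ?thesis using 2 by simp
    qed
  qed
  also have "\<dots> = (\<Sum>z | poly h z = 0 \<and> cmod z < r. of_nat (order z h))"
    by (simp add: sum.If_cases[OF fin] Collect_conj_eq Int_commute)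
  also have "\<dots> = of_nat (size {#z \<in># proots h. cmod z < r#})"
    using h by (auto simp: size_multiset_overloaded_eq intro!: sum.cong)
  finally show ?thesis .
qed

lemma Rouche_proots:
  fixes f g :: "complex poly"
  assumes "r > 0" and less: "\<And>z. cmod z = r \<Longrightarrow> cmod (poly g z) < cmod (poly f z)"
  shows "size {#z \<in># proots (f + g). cmod z < r#} = size {#z \<in># proots f. cmod z < r#}"
proof -
  have nz: "poly f z \<noteq> 0" "poly (f + g) z \<noteq> 0" if "cmod z = r" for z
  proof -
    show "poly f z \<noteq> 0" using less[OF that] by auto
    show "poly (f + g) z \<noteq> 0"
    proof
      assume "poly (f + g) z = 0"
      then have "poly g z = - poly f z" by (simp add: eq_neg_iff_add_eq_0 add.commute)
      then show False using less[OF that] by simp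
    qed
  qed
  have "f \<noteq> 0" "f + g \<noteq> 0"
    using nz[of "of_real r"] \<open>r > 0\<close> by (metis abs_of_pos norm_of_real poly_0)+
  then have "finite {z. poly f z = 0}" "finite {z. poly (f + g) z = 0}"
    using poly_roots_finite by blast+
  then have "(\<Sum>z | poly (f + g) z = 0. winding_number (circlepath 0 r) z * zorder (poly (f + g)) z)
      = (\<Sum>z | poly f z = 0. winding_number (circlepath 0 r) z * zorder (poly f) z)"
    using Rouche_theorem[of UNIV "poly f" "poly g" "circlepath 0 r"] \<open>r > 0\<close> less
    by (simp add: connected_UNIV holomorphic_intros poly_add[abs_def])
  then show ?thesis
    using sum_winding_number_circlepath_proots[OF \<open>r > 0\<close> nz(1)]
      sum_winding_number_circlepath_proots[OF \<open>r > 0\<close> nz(2)]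
    by (simp only: of_nat_eq_iff)
qed

text \<open>On a circle enclosing all roots of \<open>q\<close>, the quotient \<open>p / q\<close>
  is bounded, so \<open>t q\<close> dominates \<open>p\<close> for large \<open>t\<close>. The
  radius \<open>R\<close> depends only on \<open>q\<close>, while the threshold for \<open>t\<close>
  may depend on \<open>r\<close>; this order of quantifiers yields both boundedness and escape of
  roots later.\<close>

lemma proots_diff_smult_in_ball:
  fixes p q :: "complex poly"
  assumes "q \<noteq> 0"
  obtains R where "\<And>r. r \<ge> R \<Longrightarrow>
    \<forall>\<^sub>F t in at_top. size {#z \<in># proots (p - Polynomial.smult (of_real t) q). cmod z < r#} = degree q"
proof -
  have "finite {z. poly q z = 0}" using assms by (rule poly_roots_finite)
  then obtain B where B: "\<And>z. poly q z = 0 \<Longrightarrow> cmod z \<le> B"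
    using finite_imp_bounded[of "{z. poly q z = 0}"] by (auto simp: bounded_iff)
  \<comment> \<open>The summand 1 puts the circle strictly beyond every root of \<open>q\<close>;
    the maximum with 1 makes \<open>r\<close> positive, as \<open>B\<close> may be negative when
    \<open>q\<close> has no roots.\<close>
  show thesis
  proof (rule that[of "max 1 (B + 1)"])
    fix r assume "r \<ge> max 1 (B + 1)"
    then have r: "r > 0" "r > B" by auto
    have nz: "poly q z \<noteq> 0" if "cmod z = r" for z
      using B[of z] r that by auto
    have cont: "continuous_on (sphere 0 r) (\<lambda>z. poly p z / poly q z)"
      using nz by (intro continuous_intros) auto
    have "bounded ((\<lambda>z. poly p z / poly q z) ` sphere 0 r)"
      using compact_continuous_image[OF cont compact_sphere] compact_imp_bounded by blast
    then obtain C where C: "\<And>z. cmod z = r \<Longrightarrow> cmod (poly p z / poly q z) \<le> C"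
      by (force simp: bounded_iff)
    have "size {#z \<in># proots (p - Polynomial.smult (of_real t) q). cmod z < r#} = degree q"
      if t: "t > max 0 C" for t
    proof -
      have "cmod (poly p z) < cmod (poly (Polynomial.smult (- of_real t) q) z)" if z: "cmod z = r" for z
      proof -
        have "cmod (poly p z) \<le> C * cmod (poly q z)"
          using C[OF z] nz[OF z] by (simp add: norm_divide divide_simps)
        also have "\<dots> < t * cmod (poly q z)"
          using nz[OF z] t by simp
        finally show ?thesis using t by (simp add: norm_mult)
      qed
      \<comment> \<open>\<open>- t q\<close> is the dominant summand and \<open>p\<close> the
        perturbation; scaling by the nonzero \<open>- t\<close> keeps the roots of
        \<open>q\<close>.\<close>
      from Rouche_proots[OF r(1) this]
      have "size {#z \<in># proots (Polynomial.smult (- of_real t) q + p). cmod z < r#}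
          = size {#z \<in># proots (Polynomial.smult (- of_real t) q). cmod z < r#}" .
      also have "proots (Polynomial.smult (- of_real t) q) = proots q"
        by (rule proots_smult) (use t in auto)
      also have "{#z \<in># proots q. cmod z < r#} = proots q"
        using B r(2) assms by (force simp: filter_mset_eq_conv)
      finally show ?thesis
        by (simp add: size_proots_complex)
    qed
    then show "\<forall>\<^sub>F t in at_top. size {#z \<in># proots (p - Polynomial.smult (of_real t) q). cmod z < r#} = degree q"
      using eventually_gt_at_top[of "max 0 C"] by (auto elim: eventually_mono)
  qed
qed

section \<open>From root counts to bounded and escaping eigenvalue functions\<close>

text \<open>In a sorted list the entries below a bound form a prefix, so counting them decides which
  positions they occupy.\<close>

lemma sorted_nth_less_iff:
  fixes f :: "'a \<Rightarrow> 'b::linorder"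
  assumes "sorted (map f xs)" and "k < length xs"
  shows "f (xs ! k) < c \<longleftrightarrow> k < length (filter (\<lambda>x. f x < c) xs)"
  using assms
proof (induction xs arbitrary: k)
  case (Cons x xs)
  show ?case
  proof (cases "f x < c")
    case True
    with Cons show ?thesis by (cases k) auto
  next
    case False
    with Cons.prems(1) have *: "\<forall>y\<in>set (x # xs). \<not> f y < c" by auto
    then have "filter (\<lambda>x. f x < c) (x # xs) = []"
      by (simp add: filter_empty_conv)
    moreover have "\<not> f ((x # xs) ! k) < c"
      using * Cons.prems(2) nth_mem by blast
    ultimately show ?thesis by simp
  qed
qed simp

text \<open>Label the eigenvalues at each \<open>t\<close> by increasing modulus. Every large disc
  eventually contains exactly \<open>degree q\<close> of them, hence always those with the first
  \<open>degree q\<close> labels; the other labels leave every disc.\<close>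

lemma precisely_eigenvalues_to_infinity_char_poly:
  fixes p q :: "complex poly"
  assumes M: "\<And>t. M t \<in> carrier_mat n n"
    and cp: "\<And>t. char_poly (map_mat complex_of_real (M t)) = p - Polynomial.smult (of_real t) q"
    and "q \<noteq> 0" and deg: "degree q + l = n"
  shows "precisely_eigenvalues_to_infinity n M l"
proof -
  define m where "m = degree q"
  \<comment> \<open>Any enumeration of the multiset serves before sorting.\<close>
  define xs where "xs t = sort_key cmod (SOME xs. mset xs = eigenvalue_mset (M t))" for t
  define lam where "lam k t = xs t ! k" for k t
  have mset_xs: "mset (xs t) = eigenvalue_mset (M t)" for t
    using someI_ex[OF ex_mset[of "eigenvalue_mset (M t)"]] by (simp add: xs_def)
  have len: "length (xs t) = n" for t
  proof -
    have "length (xs t) = size (eigenvalue_mset (M t))"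
      by (metis mset_xs size_mset)
    also have "\<dots> = n"
      using degree_monic_char_poly[of "map_mat complex_of_real (M t)" n] M
      by (simp add: eigenvalue_mset_def size_proots_complex)
    finally show ?thesis .
  qed
  have funs: "eigenvalue_functions n M lam"
  proof -
    have "image_mset (\<lambda>k. lam k t) (mset_set {..<n}) = mset (xs t)" for t
    proof -
      have "xs t = map (\<lambda>k. lam k t) [0..<n]"
        by (rule nth_equalityI) (auto simp: len lam_def)
      then show ?thesis
        by (metis mset_map mset_upt atLeast0LessThan)
    qed
    then show ?thesis
      by (simp add: eigenvalue_functions_def mset_xs)
  qed
  obtain R where R: "\<And>r. r \<ge> R \<Longrightarrow>
    \<forall>\<^sub>F t in at_top. size {#z \<in># proots (p - Polynomial.smult (of_real t) q). cmod z < r#} = m"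
    using proots_diff_smult_in_ball[OF \<open>q \<noteq> 0\<close>, of p] unfolding m_def by blast
  \<comment> \<open>With \<open>r = R\<close> this bounds the labels below \<open>m\<close>; with
    \<open>r\<close> arbitrarily large it drives the remaining ones to infinity.\<close>
  have ev: "\<forall>\<^sub>F t in at_top. \<forall>k<n. cmod (lam k t) < r \<longleftrightarrow> k < m" if "r \<ge> R" for r
    using R[OF that]
  proof eventually_elim
    case (elim t)
    have "length (filter (\<lambda>z. cmod z < r) (xs t)) = m"
      using elim by (metis mset_filter size_mset mset_xs eigenvalue_mset_def cp)
    moreover have "sorted (map cmod (xs t))"
      by (simp add: xs_def)
    ultimately show ?case
      using sorted_nth_less_iff[of cmod "xs t"] len by (simp add: lam_def)
  qed
  have bdd: "Bfun (lam k) at_top" if "k < m" for k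
  proof (rule BfunI)
    show "\<forall>\<^sub>F t in at_top. cmod (lam k t) \<le> R"
      using ev[OF order_refl] by eventually_elim (use that deg m_def in \<open>simp add: less_imp_le\<close>)
  qed
  have inf: "filterlim (lam k) at_infinity at_top" if k: "m \<le> k" "k < n" for k
    unfolding filterlim_at_infinity[OF order_refl]
  proof (intro allI impI)
    fix r :: real assume "r > 0"
    show "\<forall>\<^sub>F t in at_top. r \<le> cmod (lam k t)"
      using ev[of "max r R", OF max.cobounded2] by eventually_elim (use k in \<open>auto simp: not_less\<close>)
  qed
  have not_inf: "\<not> filterlim (lam k) at_infinity at_top" if "k < m" for k
  proof
    assume "filterlim (lam k) at_infinity at_top"
    \<comment> \<open>The radius must be positive for the characterisation of
      \<open>at_infinity\<close> and at least \<open>R\<close> for \<open>ev\<close>.\<close>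
    then have "\<forall>\<^sub>F t in at_top. max R 1 \<le> cmod (lam k t)"
      by (simp only: filterlim_at_infinity[OF order_refl])
    with ev[OF max.cobounded1[of R 1]] have "\<forall>\<^sub>F t::real in at_top. False"
      by eventually_elim (use that deg m_def in \<open>simp add: not_less[symmetric]\<close>)
    then show False by simp
  qed
  have "{k \<in> {..<n}. filterlim (lam k) at_infinity at_top} = {m..<n}"
  proof (rule Set.set_eqI)
    fix k
    show "k \<in> {k \<in> {..<n}. filterlim (lam k) at_infinity at_top} \<longleftrightarrow> k \<in> {m..<n}"
      using inf[of k] not_inf[of k] by (cases "k < m") auto
  qed
  then have "card {k \<in> {..<n}. filterlim (lam k) at_infinity at_top} = l"
    using deg by (simp add: m_def)
  moreover have "\<forall>k<n. filterlim (lam k) at_infinity at_top \<or> Bfun (lam k) at_top"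
    using inf bdd not_less by blast
  ultimately show ?thesis
    using funs unfolding precisely_eigenvalues_to_infinity_def by blast
qed

section \<open>Walks as relation powers, and shortest cycles through a given arc\<close>

lemma (in pair_wf_digraph) awalk_imp_relpow:
  "awalk u p v \<Longrightarrow> (u, v) \<in> parcs G ^^ length p"
proof (induction p arbitrary: u)
  case Nil
  then show ?case by (simp add: awalk_Nil_iff)
next
  case (Cons e p)
  then have "(u, snd e) \<in> parcs G" "(snd e, v) \<in> parcs G ^^ length p"
    by (auto simp: awalk_Cons_iff)
  then show ?case by (simp del: relpow.simps add: relpow_Suc_I2)
qed

lemma (in pair_wf_digraph) relpow_imp_awalk:
  assumes "(u, v) \<in> parcs G ^^ k" and "u \<in> pverts G"
  obtains p where "awalk u p v" and "length p = k"
  using assms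
proof (induction k arbitrary: u thesis)
  case 0
  then show ?case using 0(1)[of "[]"] by (simp add: awalk_Nil_iff)
next
  case (Suc k)
  from Suc.prems(2) obtain w where w: "(u, w) \<in> parcs G" "(w, v) \<in> parcs G ^^ k"
    by (meson relpow_Suc_D2)
  obtain p where "awalk w p v" "length p = k"
    using Suc.IH[OF _ w(2)] in_arcsD2[OF w(1)] by blast
  then show ?case
    using Suc.prems(1)[of "(u, w) # p"] Suc.prems(3) w(1) by (simp add: awalk_Cons_iff)
qed

text \<open>Cutting the loops out of a walk leaves a path whose arcs are distinct and all come from
  the walk, so it is no longer than the walk.\<close>

lemma (in pair_fin_digraph) relpow_imp_apath:
  assumes "(u, v) \<in> parcs G ^^ k" and "u \<in> pverts G"
  obtains p where "apath u p v" and "length p \<le> k"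
proof -
  obtain p where p: "awalk u p v" "length p = k"
    using relpow_imp_awalk[OF assms] .
  have path: "apath u (awalk_to_apath p) v"
    using apath_awalk_to_apath[OF p(1)] .
  then have "distinct (awalk_to_apath p)"
    by (auto simp: apath_def intro: distinct_verts_imp_distinct)
  then have "length (awalk_to_apath p) \<le> card (set p)"
    using awalk_to_apath_subset[OF p(1)] by (metis List.finite_set card_mono distinct_card)
  also have "\<dots> \<le> k" using card_length[of p] p(2) by simp
  finally show thesis using that path by blast
qed

text \<open>Stop the walk at its first visit to \<open>i\<close>: the extra arc starts at
  \<open>i\<close>, so it has not been used before that moment.\<close>

lemma relpow_insert_back_arc:
  assumes "(a, i) \<in> insert (i, j) E ^^ r"
  obtains s where "s \<le> r" and "(a, i) \<in> E ^^ s"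
  using assms
proof (induction r arbitrary: a thesis)
  case 0
  then show ?case by auto
next
  case (Suc r)
  from Suc.prems(2) obtain b where b: "(a, b) \<in> insert (i, j) E" "(b, i) \<in> insert (i, j) E ^^ r"
    by (meson relpow_Suc_D2)
  show ?case
  proof (cases "a = i")
    case True
    then show ?thesis using Suc.prems(1)[of 0] by simp
  next
    case False
    then have "(a, b) \<in> E" using b(1) by auto
    moreover obtain s where "s \<le> r" "(b, i) \<in> E ^^ s"
      using Suc.IH b(2) by blast
    ultimately show ?thesis
      using Suc.prems(1)[of "Suc s"] by (meson Suc_le_mono relpow_Suc_I2)
  qed
qed

text \<open>Removing the arc \<open>(i, j)\<close> from a cycle leaves a walk from \<open>j\<close>
  back to \<open>i\<close>, and adding it to a path from \<open>j\<close> to \<open>i\<close> gives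
  a cycle. For \<open>i = j\<close> the path is empty and the cycle is a loop.\<close>

lemma shortest_cycle_length_through_eq:
  fixes G :: "'a pair_pre_digraph"
  assumes "pair_fin_digraph G" and arcs: "parcs G = insert (i, j) E"
    and reach: "(j, i) \<in> E\<^sup>*"
  shows "shortest_cycle_length_through G (i, j) = Suc (LEAST k. (j, i) \<in> E ^^ k)"
proof -
  interpret pair_fin_digraph G by fact
  define d where "d = (LEAST k. (j, i) \<in> E ^^ k)"
  have ij: "(i, j) \<in> parcs G" "i \<in> pverts G" "j \<in> pverts G"
    using arcs in_arcsD1[of i j] in_arcsD2[of i j] by auto
  have d: "(j, i) \<in> E ^^ d"
    using rtrancl_imp_relpow[OF reach] unfolding d_def by (metis LeastI)
  have cycle_ge: "Suc d \<le> length c" if c: "cycle c" "(i, j) \<in> set c" for c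
  proof -
    obtain u where u: "awalk u c u" using c(1) by (auto simp: cycle_def)
    obtain xs ys where xs: "c = xs @ (i, j) # ys" using c(2) by (meson split_list)
    \<comment> \<open>The cycle is rotated so that it starts just after the chosen occurrence of
      \<open>(i, j)\<close>. The remaining arcs may still include \<open>(i, j)\<close>, which
      \<open>relpow_insert_back_arc\<close> removes.\<close>
    have "awalk j (ys @ xs) i"
      using u by (auto simp: xs awalk_Cons_iff)
    from awalk_imp_relpow[OF this] obtain s where "s \<le> length (ys @ xs)" "(j, i) \<in> E ^^ s"
      unfolding arcs by (rule relpow_insert_back_arc)
    moreover from this have "d \<le> s" unfolding d_def by (simp add: Least_le)
    ultimately show ?thesis by (simp add: xs)
  qed
  have E_subset: "E ^^ k \<subseteq> parcs G ^^ k" for k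
    by (induction k) (simp_all add: arcs relcomp_mono subset_insertI)
  have "(j, i) \<in> parcs G ^^ d"
    using d E_subset by blast
  \<comment> \<open>A path is taken because \<open>cycle\<close> forbids repeated vertices. Its
    length is only known to be at most \<open>d\<close>; \<open>cycle_ge\<close> then forces
    equality.\<close>
  then obtain p where p: "apath j p i" "length p \<le> d"
    using relpow_imp_apath ij(3) by blast
  have cyc: "cycle ((i, j) # p)"
    using p(1) ij unfolding cycle_def apath_def
    by (intro exI[of _ i]) (auto simp: awalk_Cons_iff)
  have "length ((i, j) # p) = Suc d"
    using cycle_ge[OF cyc] p(2) by simp
  with cyc have ex: "\<exists>c. cycle c \<and> (i, j) \<in> set c \<and> length c = Suc d"
    by (intro exI[of _ "(i, j) # p"]) simp
  show ?thesis
    unfolding shortest_cycle_length_through_def d_def[symmetric]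
    by (rule Least_equality) (use ex cycle_ge in auto)
qed

section \<open>The graph of a matrix, and reachability from irreducibility\<close>

lemma pair_fin_digraph_mat_graph:
  assumes "square_mat A"
  shows "pair_fin_digraph (mat_graph A)"
  using assms by unfold_locales
    (auto simp: mat_graph_def intro: finite_subset[of _ "{..<dim_row A} \<times> {..<dim_col A}"])

lemma unit_outer_carrier [simp]: "unit_outer n i j \<in> carrier_mat n n"
  by (auto simp: unit_outer_def)

lemma dim_unit_outer [simp]:
  "dim_row (unit_outer n i j) = n" "dim_col (unit_outer n i j) = n"
  by (simp_all add: unit_outer_def)

lemma index_unit_outer [simp]:
  assumes "a < n" "b < n"
  shows "unit_outer n i j $$ (a, b) = (if a = i \<and> b = j then 1 else 0)"
  using assms by (auto simp: unit_outer_def mat_of_cols_def mat_of_rows_def scalar_prod_def unit_vec_def)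

text \<open>Nonnegativity of the old \<open>(i, j)\<close> entry prevents it from cancelling the
  added 1.\<close>

lemma parcs_mat_graph_add_unit_outer:
  assumes "A \<in> carrier_mat n n" and "nonneg_mat A" and "i < n" and "j < n"
  shows "parcs (mat_graph (A + unit_outer n i j)) = insert (i, j) (parcs (mat_graph A))"
proof -
  have "0 \<le> A $$ (a, b)" if "a < n" "b < n" for a b
    using assms that by (auto simp: nonneg_mat_def)
  then show ?thesis
    using assms by (auto simp: mat_graph_def add_nonneg_pos split: if_splits)
qed

text \<open>No arc leaves the set of vertices reachable from \<open>j\<close>. If \<open>i\<close>
  were outside, listing the unreachable vertices first and the reachable ones last would produce a
  zero lower left block.\<close>

lemma irreducible_mat_imp_reachable:
  assumes A: "A \<in> carrier_mat n n" and nonneg: "nonneg_mat A" and irr: "irreducible_mat A"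
    and "i < n" and "j < n"
  shows "(j, i) \<in> (parcs (mat_graph A))\<^sup>*"
proof (rule ccontr)
  assume unreachable: "(j, i) \<notin> (parcs (mat_graph A))\<^sup>*"
  define S where "S = {a. a < n \<and> (j, a) \<in> (parcs (mat_graph A))\<^sup>*}"
  define T where "T = {..<n} - S"
  define k where "k = card T"
  have S: "j \<in> S" "S \<subseteq> {..<n}" and T: "i \<in> T" "T \<subseteq> {..<n}"
    using assms unreachable by (auto simp: S_def T_def)
  have fin: "finite S" "finite T"
    using S T finite_subset by blast+
  have card: "card S = n - k" "k \<le> n"
    using S fin card_mono[OF _ S(2)] by (simp_all add: k_def T_def card_Diff_subset)
  \<comment> \<open>Both diagonal blocks are nontrivial, since \<open>i\<close> lies in
    \<open>T\<close> and \<open>j\<close> in \<open>S\<close>.\<close>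
  have "k > 0" "card S > 0"
    using S T fin by (auto simp: k_def card_gt_0_iff)
  have zero: "A $$ (a, b) = 0" if "a \<in> S" "b \<in> T" for a b
  proof (rule ccontr)
    assume "A $$ (a, b) \<noteq> 0"
    moreover have "a < n" "b < n" using that S T by auto
    ultimately have "(a, b) \<in> parcs (mat_graph A)"
      using nonneg A by (force simp: mat_graph_def nonneg_mat_def less_le)
    then have "b \<in> S"
      using that(1) \<open>b < n\<close> by (auto simp: S_def intro: rtrancl_into_rtrancl)
    then show False using that(2) by (simp add: T_def)
  qed
  obtain f where f: "bij_betw f {..<k} T"
    using ex_bij_betw_nat_finite[OF fin(2)] by (auto simp: k_def atLeast0LessThan)
  have "card {k..<n} = card S" by (simp add: card)
  then obtain g where g: "bij_betw g {k..<n} S"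
    using finite_same_card_bij fin(1) by blast
  \<comment> \<open>The first \<open>k\<close> positions go to \<open>T\<close> and the others to
    \<open>S\<close>; \<open>permutes\<close> demands the identity from \<open>n\<close> on.\<close>
  define p where "p a = (if a < k then f a else if a < n then g a else a)" for a
  have "bij_betw p {..<k} T"
    using f by (subst bij_betw_cong[of _ p f]) (auto simp: p_def)
  moreover have "bij_betw p {k..<n} S"
    using g by (subst bij_betw_cong[of _ p g]) (auto simp: p_def)
  ultimately have "bij_betw p ({..<k} \<union> {k..<n}) (T \<union> S)"
    by (rule bij_betw_combine) (auto simp: T_def)
  moreover have "{..<k} \<union> {k..<n} = {..<n}" "T \<union> S = {..<n}"
    using card S by (auto simp: T_def)
  ultimately have "bij_betw p {..<n} {..<n}" by simp
  then have perm: "p permutes {..<n}"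
    by (rule bij_imp_permutes) (use card in \<open>auto simp: p_def\<close>)
  have p_lt: "p a < n" if "a < n" for a
    using permutes_in_image[OF perm] that by simp
  define P where "P = mat n n (\<lambda>(i, j). if i = p j then 1 else 0 :: real)"
  have P: "permutation_mat n P" "P \<in> carrier_mat n n"
    using perm by (auto simp: permutation_mat_def P_def)
  define B where "B = transpose_mat P * A * P"
  have B: "B \<in> carrier_mat n n"
    using A P by (simp add: B_def)
  \<comment> \<open>Column \<open>b\<close> of \<open>P\<close> is the unit vector at
    \<open>p b\<close>, so conjugation by \<open>P\<close> relabels rows and columns by
    \<open>p\<close>.\<close>
  have B_index: "B $$ (a, b) = A $$ (p a, p b)" if "a < n" "b < n" for a b
  proof -
    have "(transpose_mat P * A) $$ (a, c) = A $$ (p a, c)" if "c < n" for c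
      using that \<open>a < n\<close> A p_lt
      by (auto simp: P_def scalar_prod_def if_distrib[of "\<lambda>x. x * _"] cong: if_cong)
    then show ?thesis
      using that A P p_lt
      by (auto simp: B_def P_def scalar_prod_def if_distrib[of "\<lambda>x. _ * x"] cong: if_cong)
  qed
  obtain X Y Z W where split: "split_block B k k = (X, Y, Z, W)"
    by (metis prod_cases4)
  note block = split_block[OF split, of "n - k" "n - k"]
  have dims: "dim_row B = k + (n - k)" "dim_col B = k + (n - k)"
    using B card(2) by auto
  \<comment> \<open>\<open>Z\<close> is the lower left block: its rows come from \<open>S\<close>
    and its columns from \<open>T\<close>.\<close>
  have "Z = 0\<^sub>m (n - k) k"
  proof (rule eq_matI)
    fix a b assume ab: "a < dim_row (0\<^sub>m (n - k) k :: real mat)" "b < dim_col (0\<^sub>m (n - k) k :: real mat)"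
    then have "Z $$ (a, b) = B $$ (a + k, b)"
      using split dims by (auto simp: split_block_def Let_def)
    also have "\<dots> = A $$ (p (a + k), p b)"
      using ab by (intro B_index) auto
    also have "\<dots> = 0"
    proof (rule zero)
      show "p (a + k) \<in> S" "p b \<in> T"
        using ab bij_betwE[OF f] bij_betwE[OF g] by (auto simp: p_def)
    qed
    finally show "Z $$ (a, b) = 0\<^sub>m (n - k) k $$ (a, b)" using ab by simp
  qed (use block(3)[OF dims] in auto)
  then have "B = four_block_mat X Y (0\<^sub>m (n - k) k) W"
    using block(5)[OF dims] by simp
  moreover have "X \<in> carrier_mat k k" "Y \<in> carrier_mat k (n - k)" "W \<in> carrier_mat (n - k) (n - k)"
    using block[OF dims] by auto
  ultimately show False
    using irr P \<open>k > 0\<close> \<open>card S > 0\<close> A card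
    unfolding irreducible_mat_def B_def by (metis carrier_matD(1))
qed

section \<open>The characteristic polynomial of the perturbed matrix and the degree of its
  cofactor\<close>

lemma char_poly_matrix_index:
  fixes A :: "'a::comm_ring_1 mat"
  assumes "A \<in> carrier_mat n n" "a < n" "b < n"
  shows "char_poly_matrix A $$ (a, b) = (if a = b then [:0, 1:] else 0) + [:- A $$ (a, b):]"
  using assms by (auto simp: char_poly_matrix_def)

text \<open>Expand along row \<open>i\<close>: the perturbation changes only the entry
  \<open>(i, j)\<close>, and the cofactors of row \<open>i\<close> do not see that row. The minus
  sign comes from \<open>x I - A\<close>.\<close>

lemma char_poly_add_smult_unit_outer:
  fixes A :: "real mat"
  assumes A: "A \<in> carrier_mat n n" and i: "i < n" and j: "j < n"
  shows "char_poly (A + t \<cdot>\<^sub>m unit_outer n i j)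
    = char_poly A - Polynomial.smult t (cofactor (char_poly_matrix A) i j)"
proof -
  define A' where "A' = A + t \<cdot>\<^sub>m unit_outer n i j"
  define C where "C = char_poly_matrix A"
  define C' where "C' = char_poly_matrix A'"
  have A': "A' \<in> carrier_mat n n"
    using A unit_outer_carrier[of n i j] by (simp add: A'_def)
  have C: "C \<in> carrier_mat n n" "C' \<in> carrier_mat n n"
    using A A' by (simp_all add: C_def C'_def)
  have entry: "C' $$ (a, b) = C $$ (a, b) - (if a = i \<and> b = j then [:t:] else 0)"
    if "a < n" "b < n" for a b
  proof -
    have "A' $$ (a, b) = A $$ (a, b) + (if a = i \<and> b = j then t else 0)"
      using that A unit_outer_carrier[of n i j] by (auto simp: A'_def)
    then show ?thesis
      using that A A' by (simp add: C_def C'_def char_poly_matrix_index)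
  qed
  have "mat_delete C' i b = mat_delete C i b" if "b < n" for b
    using C that i by (intro eq_matI) (auto simp: mat_delete_def entry)
  then have cof: "cofactor C' i b = cofactor C i b" if "b < n" for b
    using that by (simp add: cofactor_def)
  have "det C' = (\<Sum>b<n. C' $$ (i, b) * cofactor C i b)"
    using laplace_expansion_row[OF C(2) i] cof by simp
  also have "\<dots> = (\<Sum>b<n. C $$ (i, b) * cofactor C i b - (if b = j then [:t:] * cofactor C i j else 0))"
    using i by (intro sum.cong) (auto simp: entry algebra_simps)
  also have "\<dots> = det C - [:t:] * cofactor C i j"
    using j by (simp add: sum_subtractf laplace_expansion_row[OF C(1) i])
  finally show ?thesis
    by (simp add: char_poly_def C_def C'_def A'_def)
qed

lemma degree_cofactor_char_poly_matrix_le: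
  fixes A :: "'a::comm_ring_1 mat"
  assumes A: "A \<in> carrier_mat n n" and "i < n" and "j < n"
  shows "degree (cofactor (char_poly_matrix A) i j) \<le> n - 1"
proof -
  have "mat_delete (char_poly_matrix A) i j \<in> carrier_mat (n - 1) (n - 1)"
    using char_poly_matrix_closed[OF A] by (intro carrier_matI) (auto simp: mat_delete_def)
  moreover have "degree (mat_delete (char_poly_matrix A) i j $$ (a, b)) \<le> 1"
    if "a < n - 1" "b < n - 1" for a b
  proof -
    have "degree (char_poly_matrix A $$ (a', b')) \<le> 1" if "a' < n" "b' < n" for a' b'
      using that A by (auto simp: char_poly_matrix_index)
    then show ?thesis
      using that char_poly_matrix_closed[OF A] by (auto simp: mat_delete_def)
  qed
  ultimately have "degree (det (mat_delete (char_poly_matrix A) i j)) \<le> 1 * (n - 1)"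
    by (intro degree_det_le)
  then show ?thesis
    by (cases "even (i + j)") (simp_all add: cofactor_def)
qed

text \<open>Compare the coefficients of \<open>x^(t + 1)\<close> at position \<open>(k, i)\<close>
  of the identity \<open>(x I - A) * adj (x I - A) = char_poly A * I\<close>.\<close>

lemma coeff_cofactor_char_poly_matrix_rec:
  fixes A :: "'a::comm_ring_1 mat"
  assumes A: "A \<in> carrier_mat n n" and i: "i < n" and k: "k < n"
  shows "coeff (cofactor (char_poly_matrix A) i k) t
    = (if k = i then coeff (char_poly A) (Suc t) else 0)
      + (\<Sum>m<n. A $$ (k, m) * coeff (cofactor (char_poly_matrix A) i m) (Suc t))"
proof -
  define C where "C = char_poly_matrix A"
  have C: "C \<in> carrier_mat n n" using A by (simp add: C_def)
  have "(C * adj_mat C) $$ (k, i) = (\<Sum>m<n. C $$ (k, m) * cofactor C i m)"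
    using C i k by (auto simp: adj_mat_def scalar_prod_def atLeast0LessThan)
  also have "\<dots> = (\<Sum>m<n. (if m = k then [:0, 1:] * cofactor C i k else 0)
      - Polynomial.smult (A $$ (k, m)) (cofactor C i m))"
    using A k by (intro sum.cong) (auto simp: C_def char_poly_matrix_index algebra_simps)
  also have "\<dots> = pCons 0 (cofactor C i k) - (\<Sum>m<n. Polynomial.smult (A $$ (k, m)) (cofactor C i m))"
    using k by (simp add: sum_subtractf)
  finally have "pCons 0 (cofactor C i k) = (if k = i then char_poly A else 0)
      + (\<Sum>m<n. Polynomial.smult (A $$ (k, m)) (cofactor C i m))"
    using i k by (simp add: adj_mat(2)[OF C] char_poly_def eq_diff_eq flip: C_def split: if_splits)
  from arg_cong[OF this, of "\<lambda>f. coeff f (Suc t)"] show ?thesis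
    by (simp add: C_def coeff_sum)
qed

text \<open>In general \<open>b\<close> is the \<open>(k, i)\<close> entry of \<open>A^r\<close>
  plus a combination of those of lower powers. The lower ones vanish when no shorter walk from
  \<open>k\<close> to \<open>i\<close> exists, and the entry of \<open>A^r\<close> is positive
  exactly if a walk of length \<open>r\<close> exists.\<close>

lemma coeff_cofactor_char_poly_matrix_pos_iff:
  assumes A: "A \<in> carrier_mat n n" and nonneg: "nonneg_mat A" and i: "i < n"
    and "r < n" and "k < n" and "\<And>s. s < r \<Longrightarrow> (k, i) \<notin> parcs (mat_graph A) ^^ s"
  defines "b \<equiv> coeff (cofactor (char_poly_matrix A) i k) (n - 1 - r)"
  shows "0 \<le> b" and "0 < b \<longleftrightarrow> (k, i) \<in> parcs (mat_graph A) ^^ r"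
proof -
  define E where "E = parcs (mat_graph A)"
  define \<beta> where "\<beta> k t = coeff (cofactor (char_poly_matrix A) i k) t" for k t
  have rec: "\<beta> k t = (if k = i then coeff (char_poly A) (Suc t) else 0)
      + (\<Sum>m<n. A $$ (k, m) * \<beta> m (Suc t))" if "k < n" for k t
    unfolding \<beta>_def using coeff_cofactor_char_poly_matrix_rec[OF A i that] .
  have E: "(a, c) \<in> E \<longleftrightarrow> A $$ (a, c) > 0" and A_nonneg: "A $$ (a, c) \<ge> 0"
    if "a < n" "c < n" for a c
    using that A nonneg by (auto simp: E_def mat_graph_def nonneg_mat_def)
  have E_lt: "c < n" if "(a, c) \<in> E" for a c
    using that A by (auto simp: E_def mat_graph_def)
  have "0 \<le> \<beta> k (n - 1 - r) \<and> (0 < \<beta> k (n - 1 - r) \<longleftrightarrow> (k, i) \<in> E ^^ r)"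
    using assms(4-6) unfolding E_def[symmetric]
  proof (induction r arbitrary: k)
    case 0
    \<comment> \<open>The degree bound kills the sum in the recurrence, which leaves only the
      leading coefficient 1 of the characteristic polynomial, and that only for
      \<open>k = i\<close>.\<close>
    have "\<beta> m n = 0" if "m < n" for m
      unfolding \<beta>_def using degree_cofactor_char_poly_matrix_le[OF A i that] 0
      by (intro coeff_eq_0) linarith
    then have "\<beta> k (n - 1) = (if k = i then 1 else 0)"
      using rec[of k "n - 1"] 0 degree_monic_char_poly[OF A] by simp
    then show ?case by simp
  next
    case (Suc r)
    \<comment> \<open>The absence of a walk of length 0 removes the characteristic polynomial from
      the recurrence. The index identity below relies on \<open>Suc r < n\<close> because
      subtraction is truncated.\<close>
    have "k \<noteq> i" using Suc.prems(3)[of 0] by auto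
    moreover have "Suc (n - 1 - Suc r) = n - 1 - r" using Suc.prems(1) by linarith
    ultimately have eq: "\<beta> k (n - 1 - Suc r) = (\<Sum>m<n. A $$ (k, m) * \<beta> m (n - 1 - r))"
      using rec[of k "n - 1 - Suc r"] Suc.prems by simp
    have IH: "0 \<le> \<beta> m (n - 1 - r)" "0 < \<beta> m (n - 1 - r) \<longleftrightarrow> (m, i) \<in> E ^^ r"
      if "(k, m) \<in> E" for m
    proof -
      \<comment> \<open>A walk from \<open>m\<close> that is too short would extend along
        \<open>(k, m)\<close> to one from \<open>k\<close> that is too short. This works for
        successors of \<open>k\<close> only; for every other \<open>m\<close> the factor
        \<open>A $$ (k, m)\<close> is 0.\<close>
      have "(m, i) \<notin> E ^^ s" if "s < r" for s
        using Suc.prems(3)[of "Suc s"] that relpow_Suc_I2[OF \<open>(k, m) \<in> E\<close>] by blast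
      then show "0 \<le> \<beta> m (n - 1 - r)" "0 < \<beta> m (n - 1 - r) \<longleftrightarrow> (m, i) \<in> E ^^ r"
        using Suc.IH[of m] Suc.prems(1) E_lt[OF that] by auto
    qed
    have nn: "0 \<le> A $$ (k, m) * \<beta> m (n - 1 - r)" if "m < n" for m
      using IH(1)[of m] E[OF Suc.prems(2) that] A_nonneg[OF Suc.prems(2) that]
      by (cases "(k, m) \<in> E") auto
    have "0 < \<beta> k (n - 1 - Suc r) \<longleftrightarrow> (\<exists>m<n. 0 < A $$ (k, m) * \<beta> m (n - 1 - r))"
      unfolding eq using nn sum_nonneg_eq_0_iff[of "{..<n}"]
      by (metis (no_types, lifting) finite_lessThan lessThan_iff less_le sum_nonneg)
    also have "\<dots> \<longleftrightarrow> (\<exists>m. (k, m) \<in> E \<and> (m, i) \<in> E ^^ r)"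
      using IH E[OF Suc.prems(2)] A_nonneg[OF Suc.prems(2)] E_lt
      by (metis zero_less_mult_pos mult_pos_pos less_le mult_zero_left)
    also have "\<dots> \<longleftrightarrow> (k, i) \<in> E ^^ Suc r"
      by (metis relpow_Suc_D2 relpow_Suc_I2)
    finally show ?case
      unfolding eq using nn by (intro conjI sum_nonneg) auto
  qed
  then show "0 \<le> b" "0 < b \<longleftrightarrow> (k, i) \<in> parcs (mat_graph A) ^^ r"
    by (simp_all add: b_def \<beta>_def E_def)
qed

text \<open>The first length at which a walk from \<open>j\<close> to \<open>i\<close> exists is
  \<open>d\<close>, so the highest nonzero coefficient of the cofactor is that of
  \<open>x^(n - 1 - d)\<close>.\<close>

lemma degree_cofactor_char_poly_matrix:
  assumes A: "A \<in> carrier_mat n n" and "nonneg_mat A" and "i < n" and "j < n"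
    and reach: "(j, i) \<in> (parcs (mat_graph A))\<^sup>*"
  defines "d \<equiv> LEAST k. (j, i) \<in> parcs (mat_graph A) ^^ k"
  shows "cofactor (char_poly_matrix A) i j \<noteq> 0"
    and "degree (cofactor (char_poly_matrix A) i j) + Suc d = n"
proof -
  define q where "q = cofactor (char_poly_matrix A) i j"
  have d: "(j, i) \<in> parcs (mat_graph A) ^^ d"
    using rtrancl_imp_relpow[OF reach] unfolding d_def by (metis LeastI)
  have less_d: "(j, i) \<notin> parcs (mat_graph A) ^^ s" if "s < d" for s
    using that not_less_Least unfolding d_def by blast
  \<comment> \<open>A shortest walk is no longer than a path, and a path has fewer arcs than the
    graph has vertices. This makes \<open>n - 1 - d\<close> an untruncated difference.\<close>
  have "d < n"
  proof -
    interpret pair_fin_digraph "mat_graph A"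
      by (rule pair_fin_digraph_mat_graph) (use A in auto)
    have "j \<in> pverts (mat_graph A)" using A \<open>j < n\<close> by (simp add: mat_graph_def)
    then obtain p where p: "apath j p i" using relpow_imp_apath[OF d] by blast
    then have "(j, i) \<in> parcs (mat_graph A) ^^ length p"
      by (simp add: apath_def awalk_imp_relpow)
    then have "d \<le> length p" unfolding d_def by (rule Least_le)
    also have "\<dots> < card (pverts (mat_graph A))" using length_apath_less[OF p] .
    finally show ?thesis using A by (simp add: mat_graph_def)
  qed
  note coeff_q = coeff_cofactor_char_poly_matrix_pos_iff[OF assms(1-3) _ \<open>j < n\<close>, folded q_def]
  have pos: "0 < coeff q (n - 1 - d)"
    using coeff_q(2)[OF \<open>d < n\<close> less_d] d by simp
  have zero: "coeff q t = 0" if "t > n - 1 - d" for t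
  proof (cases "t \<le> n - 1")
    case True
    define r where "r = n - 1 - t"
    have r: "r < d" "r < n" "t = n - 1 - r"
      using True that \<open>d < n\<close> by (auto simp: r_def)
    \<comment> \<open>For \<open>r < d\<close> the coefficient is nonnegative but not positive,
      hence 0.\<close>
    have "\<not> 0 < coeff q (n - 1 - r)" "0 \<le> coeff q (n - 1 - r)"
      using coeff_q[OF r(2)] less_d r(1) by (meson less_trans)+
    then show ?thesis using r(3) by simp
  next
    case False
    then show ?thesis
      using degree_cofactor_char_poly_matrix_le[OF A \<open>i < n\<close> \<open>j < n\<close>]
      by (intro coeff_eq_0) (simp add: q_def)
  qed
  have "degree q = n - 1 - d"
    using pos zero by (intro antisym degree_le le_degree) auto
  then show "degree (cofactor (char_poly_matrix A) i j) + Suc d = n"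
    using \<open>d < n\<close> by (simp add: q_def)
  show "cofactor (char_poly_matrix A) i j \<noteq> 0"
    using pos by (auto simp: q_def)
qed

theorem theorem28:
  fixes A :: "real mat" and n i\<^sub>0 j\<^sub>0 l :: nat
  assumes "A \<in> carrier_mat n n"
    and "nonneg_mat A"
    and "irreducible_mat A"
    and "i\<^sub>0 < n" and "j\<^sub>0 < n"
    and "l = shortest_cycle_length_through (mat_graph (A + unit_outer n i\<^sub>0 j\<^sub>0)) (i\<^sub>0, j\<^sub>0)"
  shows "precisely_eigenvalues_to_infinity n (\<lambda>\<tau>. A + \<tau> \<cdot>\<^sub>m unit_outer n i\<^sub>0 j\<^sub>0) l"
proof (rule precisely_eigenvalues_to_infinity_char_poly)
  define q where "q = cofactor (char_poly_matrix A) i\<^sub>0 j\<^sub>0"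
  note A = assms(1) and i = assms(4) and j = assms(5)
  have reach: "(j\<^sub>0, i\<^sub>0) \<in> (parcs (mat_graph A))\<^sup>*"
    using irreducible_mat_imp_reachable[OF assms(1-5)] .
  note deg = degree_cofactor_char_poly_matrix[OF assms(1,2) i j reach, folded q_def]
  \<comment> \<open>The arc \<open>(i\<^sub>0, j\<^sub>0)\<close> adds one to the distance from
    \<open>j\<^sub>0\<close> to \<open>i\<^sub>0\<close>, which is exactly the \<open>Suc\<close> in
    the degree formula for \<open>q\<close>.\<close>
  have "l = Suc (LEAST k. (j\<^sub>0, i\<^sub>0) \<in> parcs (mat_graph A) ^^ k)"
    unfolding assms(6) using A
    by (intro shortest_cycle_length_through_eq pair_fin_digraph_mat_graph
        parcs_mat_graph_add_unit_outer assms(2) i j reach) auto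
  then show "degree (map_poly complex_of_real q) + l = n"
    using deg(2) by simp
  show "map_poly complex_of_real q \<noteq> 0"
    using deg(1) by simp
  show carrier: "A + t \<cdot>\<^sub>m unit_outer n i\<^sub>0 j\<^sub>0 \<in> carrier_mat n n" for t
    using A by simp
  show "char_poly (map_mat complex_of_real (A + t \<cdot>\<^sub>m unit_outer n i\<^sub>0 j\<^sub>0))
      = map_poly complex_of_real (char_poly A)
        - Polynomial.smult (of_real t) (map_poly complex_of_real q)" for t
    \<comment> \<open>The identity is proved over the reals and carried to complex polynomials
      coefficientwise.\<close>
    unfolding of_real_hom.char_poly_hom[OF carrier] char_poly_add_smult_unit_outer[OF A i j]
    by (intro poly_eqI) (simp add: q_def coeff_map_poly)
qed

end
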